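(* For any $\gamma\in(0,1]$ and any integer $k>0$, there exists a monotone normalized function $f$ on a ground set of size $k$ that is $\gamma$-weakly submodular from below but is not $\beta$-weakly submodular from above for any $\beta<\binom{k-\gamma}{k-1}$, where $\binom{k-\gamma}{k-1}=\prod_{\ell=1}^{k-1}\frac{\ell+1-\gamma}{\ell}=\Theta(k^{1-\gamma})$.
   Context: $f:2^X\to\mathbb{R}_{\ge0}$ is monotone if $f(A)\le f(B)$ for $A\subseteq B$, normalized if $f(\emptyset)=0$; $f(e\mid A)=f(A\cup\{e\})-f(A)$. $f$ is $\gamma$-weakly submodular from below if $\gamma(f(B)-f(A))\le\sum_{e\in B\setminus A}f(e\mid A)$ for all $A\subseteq B\subseteq X$, and $\beta$-weakly submodular from above if $\beta(f(B)-f(A))\ge\sum_{e\in B\setminus A}f(e\mid B\setminus\{e\})$ for all $A\subseteq B\subseteq X$. *)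

theory Defs
  imports Complex_Main "HOL-Library.FuncSet" "HOL-Library.Landau_Symbols"
begin

definition marginal :: "('a set \<Rightarrow> real) \<Rightarrow> 'a \<Rightarrow> 'a set \<Rightarrow> real" where
  "marginal f e A = f (A \<union> {e}) - f A"

definition weakly_submodular_from_below :: "'a set \<Rightarrow> real \<Rightarrow> ('a set \<Rightarrow> real) \<Rightarrow> bool" where
  "weakly_submodular_from_below X \<gamma> f \<longleftrightarrow>
     (\<forall>A B. A \<subseteq> B \<and> B \<subseteq> X \<longrightarrow> \<gamma> * (f B - f A) \<le> (\<Sum>e\<in>B - A. marginal f e A))"

definition weakly_submodular_from_above :: "'a set \<Rightarrow> real \<Rightarrow> ('a set \<Rightarrow> real) \<Rightarrow> bool" where
  "weakly_submodular_from_above X \<beta> f \<longleftrightarrow>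
     (\<forall>A B. A \<subseteq> B \<and> B \<subseteq> X \<longrightarrow> \<beta> * (f B - f A) \<ge> (\<Sum>e\<in>B - A. marginal f e (B - {e})))"

end

theory Submission
  imports Defs "HOL-Analysis.Gamma_Function" "HOL-Real_Asymp.Real_Asymp"
begin

text \<open>
  Let $P(m) = \prod_{l=1}^{m-1} (l+1-\gamma)/l$ and $R(m) = m / P(m)$. The symmetric function
  $f(A) = R(k) - R(k - |A|)$ works. The recursion for $P$ says
  $R(m) - R(m-1) = \gamma R(m) / m$ for $m \ge 2$, which is the inequality from below for $|X - A| = m$
  and $B = X$, with equality; it extends to smaller $B$ because $R(m)/m = 1/P(m)$ is nonincreasing.
  The last element added to $X$ always has marginal value $R(1) = 1$, so the inequality from above
  for $A = \emptyset$ and $B = X$ reads $\beta R(k) \ge k$, that is, $\beta \ge P(k)$.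
\<close>

definition ratio_prod :: "real \<Rightarrow> nat \<Rightarrow> real" where
  "ratio_prod \<gamma> m = (\<Prod>l = 1..m - 1. (real l + 1 - \<gamma>) / real l)"

text \<open>This is R: what f still lacks of f(X) when m elements of X are missing. Also R(m)/m =
  1/P(m) for m > 0, the slope of the chord from the origin.\<close>

definition deficit :: "real \<Rightarrow> nat \<Rightarrow> real" where
  "deficit \<gamma> m = real m / ratio_prod \<gamma> m"

lemma ratio_prod_1 [simp]: "ratio_prod \<gamma> (Suc 0) = 1"
  by (simp add: ratio_prod_def)

text \<open>At m = 0 the recursion fails: both products are empty, hence 1, but the new factor is a
  division by zero, hence 0.\<close>

lemma ratio_prod_Suc:
  assumes "m > 0"
  shows "ratio_prod \<gamma> (Suc m) = ratio_prod \<gamma> m * ((real m + 1 - \<gamma>) / real m)"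
proof -
  obtain n where "m = Suc n" using assms by (cases m) auto
  then show ?thesis by (simp add: ratio_prod_def)
qed

lemma ratio_prod_pos:
  assumes "\<gamma> \<le> 1"
  shows "ratio_prod \<gamma> m > 0"
  unfolding ratio_prod_def using assms by (intro prod_pos) auto

text \<open>Every factor (l+1-\<gamma>)/l is at least 1 because \<gamma> \<le> 1.\<close>

lemma ratio_prod_mono:
  assumes "\<gamma> \<le> 1" "0 < m" "m \<le> n"
  shows "ratio_prod \<gamma> m \<le> ratio_prod \<gamma> n"
  using assms(3)
proof (induction n rule: dec_induct)
  case (step n)
  have "ratio_prod \<gamma> n * 1 \<le> ratio_prod \<gamma> n * ((real n + 1 - \<gamma>) / real n)"
    using assms step ratio_prod_pos[OF assms(1), of n] by (intro mult_left_mono) auto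
  then show ?case
    using step assms by (simp add: ratio_prod_Suc)
qed simp

text \<open>With n = k-1, the binomial is the rising factorial
  (2-\<gamma>)(3-\<gamma>)...(n+1-\<gamma>) over n!, and pairing the l-th factors gives the
  product.\<close>

lemma gbinomial_eq_ratio_prod:
  assumes "k > 0"
  shows "(real k - \<gamma>) gchoose (k - 1) = ratio_prod \<gamma> k"
proof -
  obtain n where k: "k = Suc n" using assms by (cases k) auto
  have "(real k - \<gamma>) gchoose (k - 1) = pochhammer (2 - \<gamma>) n / fact n"
    by (simp add: k gbinomial_pochhammer' algebra_simps)
  also have "\<dots> = ratio_prod \<gamma> (Suc n)"
  proof (induction n)
    case (Suc n)
    have "pochhammer (2 - \<gamma>) (Suc n) / fact (Suc n) =
        pochhammer (2 - \<gamma>) n / fact n * ((real (Suc n) + 1 - \<gamma>) / real (Suc n))"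
      by (simp add: pochhammer_Suc algebra_simps)
    also have "\<dots> = ratio_prod \<gamma> (Suc (Suc n))"
      by (simp only: Suc.IH ratio_prod_Suc zero_less_Suc)
    finally show ?case .
  qed simp
  finally show ?thesis by (simp add: k)
qed

lemma deficit_0 [simp]: "deficit \<gamma> 0 = 0"
  by (simp add: deficit_def)

lemma deficit_1 [simp]: "deficit \<gamma> (Suc 0) = 1"
  by (simp add: deficit_def)

text \<open>Inserting P(m) = P(m+1) m/(m+1-\<gamma>) gives R(m) = (m+1-\<gamma>)/P(m+1), which is
  R(m+1) - \<gamma>/P(m+1).\<close>

lemma deficit_Suc_diff:
  assumes "\<gamma> \<le> 1" "m > 0"
  shows "deficit \<gamma> (Suc m) - deficit \<gamma> m = \<gamma> * deficit \<gamma> (Suc m) / real (Suc m)"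
  using assms ratio_prod_pos[OF assms(1), of m]
  by (simp add: deficit_def ratio_prod_Suc divide_simps) (simp add: algebra_simps)

lemma deficit_nonneg: "\<gamma> \<le> 1 \<Longrightarrow> 0 \<le> deficit \<gamma> m"
  using ratio_prod_pos[of \<gamma> m] by (simp add: deficit_def)

lemma mono_deficit:
  assumes "0 \<le> \<gamma>" "\<gamma> \<le> 1"
  shows "mono (deficit \<gamma>)"
proof (rule incseq_SucI)
  fix m
  show "deficit \<gamma> m \<le> deficit \<gamma> (Suc m)"
  proof (cases "m = 0")
    case False
    have "0 \<le> \<gamma> * deficit \<gamma> (Suc m) / real (Suc m)"
      using assms deficit_nonneg[OF assms(2)] by simp
    then show ?thesis
      using deficit_Suc_diff[OF assms(2), of m] False by simp
  qed simp
qed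

text \<open>R lies above its chord from the origin, since the slope R(n)/n = 1/P(n) is
  nonincreasing.\<close>

lemma deficit_star_shaped:
  assumes "\<gamma> \<le> 1" "n \<le> m" "m > 0"
  shows "real n / real m * deficit \<gamma> m \<le> deficit \<gamma> n"
proof (cases "n = 0")
  case False
  then have "real n / ratio_prod \<gamma> m \<le> real n / ratio_prod \<gamma> n"
    using assms ratio_prod_mono[of \<gamma> n m] ratio_prod_pos[OF assms(1), of n]
    by (intro divide_left_mono) auto
  then show ?thesis using assms by (simp add: deficit_def)
qed simp

text \<open>The inequality from below for m = |X - A| and n = |X - B|: the right side is a sum of m
  - n equal marginals. The chord bound replaces R(n) by (n/m) R(m), and the recursion then gives
  equality.\<close>

lemma deficit_increment_bound:
  assumes "\<gamma> \<le> 1" "0 \<le> \<gamma>" "n < m"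
  shows "\<gamma> * (deficit \<gamma> m - deficit \<gamma> n) \<le> real (m - n) * (deficit \<gamma> m - deficit \<gamma> (m - 1))"
\<comment> \<open>The recursion for R does not reach the step from 0 to 1. Here n = 0 and the claim
  reads \<gamma> \<le> 1.\<close>
proof (cases "m = 1")
  case True
  then show ?thesis using assms by simp
next
  case False
  then obtain q where q: "m = Suc q" "q > 0" using assms by (cases m) auto
  have "\<gamma> * (deficit \<gamma> m - deficit \<gamma> n) \<le> \<gamma> * (deficit \<gamma> m - real n / real m * deficit \<gamma> m)"
    using assms deficit_star_shaped[of \<gamma> n m] by (intro mult_left_mono) auto
  also have "\<dots> = real (m - n) * (\<gamma> * deficit \<gamma> m / real m)"
    using assms by (simp add: of_nat_diff field_simps)
  also have "\<gamma> * deficit \<gamma> m / real m = deficit \<gamma> m - deficit \<gamma> (m - 1)"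
    using deficit_Suc_diff[OF assms(1) q(2)] q by simp
  finally show ?thesis .
qed

definition deficit_fun :: "real \<Rightarrow> 'a set \<Rightarrow> 'a set \<Rightarrow> real" where
  "deficit_fun \<gamma> X A = deficit \<gamma> (card X) - deficit \<gamma> (card (X - A))"

lemma deficit_fun_empty [simp]: "deficit_fun \<gamma> X {} = 0"
  by (simp add: deficit_fun_def)

lemma mono_on_deficit_fun:
  assumes "finite X" "0 \<le> \<gamma>" "\<gamma> \<le> 1"
  shows "mono_on (Pow X) (deficit_fun \<gamma> X)"
proof (rule mono_onI)
  fix A B assume "A \<in> Pow X" "B \<in> Pow X" "A \<le> B"
  then have "card (X - B) \<le> card (X - A)"
    using assms by (intro card_mono) auto
  then show "deficit_fun \<gamma> X A \<le> deficit_fun \<gamma> X B"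
    using monoD[OF mono_deficit[OF assms(2,3)]] by (simp add: deficit_fun_def)
qed

lemma deficit_fun_below:
  assumes "finite X" "0 \<le> \<gamma>" "\<gamma> \<le> 1"
  shows "weakly_submodular_from_below X \<gamma> (deficit_fun \<gamma> X)"
  unfolding weakly_submodular_from_below_def
proof (intro allI impI, elim conjE)
  fix A B assume AB: "A \<subseteq> B" "B \<subseteq> X"
  show "\<gamma> * (deficit_fun \<gamma> X B - deficit_fun \<gamma> X A) \<le> (\<Sum>e\<in>B - A. marginal (deficit_fun \<gamma> X) e A)"
  proof (cases "A = B")
    case False
    define m n where "m = card (X - A)" and "n = card (X - B)"
    have "n < m"
      unfolding m_def n_def using AB False assms(1) by (intro psubset_card_mono) auto
    have "card (B - A) = card ((X - A) - (X - B))"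
      using AB by (intro arg_cong[where f = card]) auto
    also have "\<dots> = m - n"
      unfolding m_def n_def using AB assms(1) by (intro card_Diff_subset) (auto intro: finite_subset)
    finally have card_diff: "card (B - A) = m - n" .
    \<comment> \<open>f depends only on the number of missing elements, and adding any e outside A
      lowers it from m to m - 1.\<close>
    have "marginal (deficit_fun \<gamma> X) e A = deficit \<gamma> m - deficit \<gamma> (m - 1)" if "e \<in> B - A" for e
    proof -
      have "X - insert e A = (X - A) - {e}" by auto
      then have "card (X - insert e A) = m - 1"
        using that AB assms(1) by (auto simp: m_def)
      then show ?thesis by (simp add: marginal_def deficit_fun_def m_def)
    qed
    then have "(\<Sum>e\<in>B - A. marginal (deficit_fun \<gamma> X) e A) =
        real (m - n) * (deficit \<gamma> m - deficit \<gamma> (m - 1))"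
      by (simp add: card_diff)
    moreover have "deficit_fun \<gamma> X B - deficit_fun \<gamma> X A = deficit \<gamma> m - deficit \<gamma> n"
      by (simp add: deficit_fun_def m_def n_def)
    ultimately show ?thesis
      using deficit_increment_bound[OF assms(3,2) \<open>n < m\<close>] by simp
  qed simp
qed

lemma deficit_fun_above_imp:
  assumes "finite X" "X \<noteq> {}" "\<gamma> \<le> 1" "weakly_submodular_from_above X \<beta> (deficit_fun \<gamma> X)"
  shows "ratio_prod \<gamma> (card X) \<le> \<beta>"
proof -
  have "marginal (deficit_fun \<gamma> X) e (X - {e}) = 1" if "e \<in> X" for e
  proof -
    have "X - (X - {e}) = {e}" using that by auto
    then show ?thesis using that by (simp add: marginal_def deficit_fun_def insert_absorb)
  qed
  then have "(\<Sum>e\<in>X - {}. marginal (deficit_fun \<gamma> X) e (X - {e})) = real (card X)"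
    by simp
  \<comment> \<open>The instance A = {}, B = X; the difference \<open>X - {}\<close> is kept so that
    the definition matches literally.\<close>
  moreover have "(\<Sum>e\<in>X - {}. marginal (deficit_fun \<gamma> X) e (X - {e}))
      \<le> \<beta> * (deficit_fun \<gamma> X X - deficit_fun \<gamma> X {})"
    using assms(4) unfolding weakly_submodular_from_above_def by blast
  ultimately have "real (card X) \<le> \<beta> * (real (card X) / ratio_prod \<gamma> (card X))"
    by (simp add: deficit_fun_def deficit_def)
  moreover have "real (card X) > 0" using assms by (simp add: card_gt_0_iff)
  ultimately show ?thesis
    using ratio_prod_pos[OF assms(3), of "card X"] by (simp add: field_simps)
qed

text \<open>The quotient tends to 1/\<Gamma>(2-\<gamma>), which is nonzero as 2-\<gamma> > 0.
  Negating the upper index turns the binomial, whose upper index varies, into one with fixed upper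
  index \<gamma>-2, to which \<open>gbinomial_asymptotic\<close> applies.\<close>

lemma gbinomial_shifted_bigtheta:
  fixes \<gamma> :: real
  assumes "\<gamma> \<le> 1"
  shows "(\<lambda>k::nat. (real k - \<gamma>) gchoose (k - 1)) \<in> \<Theta>(\<lambda>k. real k powr (1 - \<gamma>))"
proof (rule bigthetaI_tendsto)
  show "inverse (Gamma (2 - \<gamma>)) \<noteq> 0"
    using Gamma_real_pos[of "2 - \<gamma>"] assms by (simp add: less_imp_neq [symmetric])
  have "(\<lambda>n. ((\<gamma> - 2) gchoose n) / ((-1)^n / exp ((\<gamma> - 2 + 1) * ln (real n))))
      \<longlonglongrightarrow> inverse (Gamma (2 - \<gamma>))"
    using gbinomial_asymptotic[of "\<gamma> - 2"] by simp
  \<comment> \<open>The known asymptotics compare with a power of n = k-1; this factor converts it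
    to a power of k.\<close>
  moreover have "(\<lambda>n. real n powr (1 - \<gamma>) / real (Suc n) powr (1 - \<gamma>)) \<longlonglongrightarrow> 1"
    by real_asymp
  ultimately have "(\<lambda>n. ((\<gamma> - 2) gchoose n) / ((-1)^n / exp ((\<gamma> - 2 + 1) * ln (real n))) *
      (real n powr (1 - \<gamma>) / real (Suc n) powr (1 - \<gamma>))) \<longlonglongrightarrow> inverse (Gamma (2 - \<gamma>)) * 1"
    by (rule tendsto_mult)
  moreover have "\<forall>\<^sub>F n in sequentially.
      ((\<gamma> - 2) gchoose n) / ((-1)^n / exp ((\<gamma> - 2 + 1) * ln (real n))) *
        (real n powr (1 - \<gamma>) / real (Suc n) powr (1 - \<gamma>)) =
      ((real (Suc n) - \<gamma>) gchoose (Suc n - 1)) / real (Suc n) powr (1 - \<gamma>)"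
    using eventually_gt_at_top[of 0]
  proof eventually_elim
    case (elim n)
    have "(real (Suc n) - \<gamma>) gchoose n = (-1) ^ n * ((\<gamma> - 2) gchoose n)"
      by (subst gbinomial_negated_upper) simp
    \<comment> \<open>The exponential is n to the power \<gamma>-1. At n = 0 the product is 0, so n
      > 0 is required.\<close>
    moreover have "exp ((\<gamma> - 2 + 1) * ln (real n)) * real n powr (1 - \<gamma>) = 1"
      using elim by (simp add: powr_def flip: exp_add) (simp add: algebra_simps)
    ultimately show ?case
      by (simp add: divide_simps power_mult_distrib [symmetric] mult_ac)
  qed
  ultimately have "(\<lambda>n. ((real (Suc n) - \<gamma>) gchoose (Suc n - 1)) / real (Suc n) powr (1 - \<gamma>))
      \<longlonglongrightarrow> inverse (Gamma (2 - \<gamma>))"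
    by (subst (asm) tendsto_cong) auto
  then show "(\<lambda>k. ((real k - \<gamma>) gchoose (k - 1)) / real k powr (1 - \<gamma>))
      \<longlonglongrightarrow> inverse (Gamma (2 - \<gamma>))"
    by (rule LIMSEQ_imp_Suc)
qed

theorem theorem5:
  fixes \<gamma> :: real
  assumes "0 < \<gamma>" and "\<gamma> \<le> 1"
  shows "(\<forall>k::nat. 0 < k \<longrightarrow>
            (\<exists>(X :: nat set) (f :: nat set \<Rightarrow> real).
               finite X \<and> card X = k \<and>
               f \<in> Pow X \<rightarrow> {0..} \<and> mono_on (Pow X) f \<and> f {} = 0 \<and>
               weakly_submodular_from_below X \<gamma> f \<and>
               (\<forall>\<beta>::real. \<beta> < (real k - \<gamma>) gchoose (k - 1) \<longrightarrow>
                  \<not> weakly_submodular_from_above X \<beta> f)) \<and>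
            (real k - \<gamma>) gchoose (k - 1) = (\<Prod>l = 1..k - 1. (real l + 1 - \<gamma>) / real l)) \<and>
         (\<lambda>k::nat. (real k - \<gamma>) gchoose (k - 1)) \<in> \<Theta>(\<lambda>k. real k powr (1 - \<gamma>))"
proof (intro conjI allI impI)
  fix k :: nat assume "0 < k"
  let ?X = "{..<k}"
  let ?f = "deficit_fun \<gamma> ?X"
  have mono: "mono_on (Pow ?X) ?f"
    using assms by (intro mono_on_deficit_fun) auto
  have "0 \<le> ?f A" if "A \<subseteq> ?X" for A
    using mono_onD[OF mono, of "{}" A] that by simp
  \<comment> \<open>Contrapositive of the lower bound on \<beta>, with the threshold rewritten as
    P(k); k > 0 makes the ground set nonempty.\<close>
  moreover have "\<not> weakly_submodular_from_above ?X \<beta> ?f"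
    if "\<beta> < (real k - \<gamma>) gchoose (k - 1)" for \<beta>
    using that deficit_fun_above_imp[of ?X \<gamma> \<beta>] assms \<open>0 < k\<close>
      gbinomial_eq_ratio_prod[OF \<open>0 < k\<close>, of \<gamma>]
    by (auto simp: lessThan_empty_iff)
  ultimately show "\<exists>(X :: nat set) (f :: nat set \<Rightarrow> real).
      finite X \<and> card X = k \<and>
      f \<in> Pow X \<rightarrow> {0..} \<and> mono_on (Pow X) f \<and> f {} = 0 \<and>
      weakly_submodular_from_below X \<gamma> f \<and>
      (\<forall>\<beta>::real. \<beta> < (real k - \<gamma>) gchoose (k - 1) \<longrightarrow> \<not> weakly_submodular_from_above X \<beta> f)"
    using mono assms deficit_fun_below[of ?X \<gamma>]
    by (intro exI[of _ ?X] exI[of _ ?f]) auto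
  show "(real k - \<gamma>) gchoose (k - 1) = (\<Prod>l = 1..k - 1. (real l + 1 - \<gamma>) / real l)"
    using gbinomial_eq_ratio_prod[OF \<open>0 < k\<close>] by (simp add: ratio_prod_def)
next
  show "(\<lambda>k::nat. (real k - \<gamma>) gchoose (k - 1)) \<in> \<Theta>(\<lambda>k. real k powr (1 - \<gamma>))"
    using assms by (intro gbinomial_shifted_bigtheta)
qed

end
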